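(* There exists a measure $\mu$ on $\mathbb{R}^d$ such that for any integers $N\ge 1$ and $\Lambda\ge 2$ there exists a finite collection $\mathcal{E}$ of dyadic rectangles with $\|\mathcal{E}\|_{\mathrm{Carleson}(\mu)}\le\Lambda$ such that any partition of $\mathcal{E}$ into $N$ subfamilies has at least one subfamily $\mathcal{E}_i$ with $\|\mathcal{E}_i\|_{\mathrm{Carleson}(\mu)}\ge\frac12\Lambda$.
   Context: A dyadic rectangle in $\mathbb{R}^d$ is an axis-parallel rectangle $I_1\times\dots\times I_d$ whose sides are dyadic intervals, i.e. each $I_j$ has the form $[k2^n,(k+1)2^n)$ with $k,n\in\mathbb{Z}$ (the $n$ may differ for different $j$). A collection (or family) is an unordered sequence of sets, with repeated elements allowed; sums over a collection count multiplicity. All sets in a collection are assumed to have finite $\mu$-measure. For a collection $\mathcal{F}$ let $\mathrm{sh}(\mathcal{F})=\bigcup_{R\in\mathcal{F}}R$. With the convention $\frac00=0$, the Carleson constant is $$\|\mathcal{E}\|_{\mathrm{Carleson}(\mu)}=\sup\Bigl\{\frac{1}{\mu(\mathrm{sh}(\mathcal{F}))}\sum_{R\in\mathcal{F}}\mu(R):\ \mathcal{F}\subseteq\mathcal{E}\Bigr\}.$$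
   Formalization: The dimension d is assumed to be at least 2; for d = 1 the claim is false, since sorting dyadic intervals by generation modulo N gives subfamilies with Carleson constant at most 1 + (Λ−1)/N (for example Λ = 10, N = 20). *)

theory Defs
  imports "HOL-Analysis.Analysis" "HOL-Library.Multiset"
begin

definition dyadic_interval :: "real set \<Rightarrow> bool" where
  "dyadic_interval I \<longleftrightarrow>
     (\<exists>k n :: int. I = {of_int k * 2 powi n ..< (of_int k + 1) * 2 powi n})"

definition dyadic_rectangle :: "(real ^ 'd) set \<Rightarrow> bool" where
  "dyadic_rectangle R \<longleftrightarrow>
     (\<exists>I. (\<forall>j. dyadic_interval (I j)) \<and> R = {x. \<forall>j. x $ j \<in> I j})"

text \<open>
  Finite collections with repetition are multisets; subcollections are
  submultisets, and sums count multiplicity.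
\<close>

definition sh :: "'a set multiset \<Rightarrow> 'a set" where
  "sh F = (\<Union>R \<in> set_mset F. R)"

text \<open>
  Division on \<^typ>\<open>ennreal\<close> satisfies \<open>0 / 0 = 0\<close>, which is the convention
  wanted here. The numerator vanishes whenever the denominator does, and for
  sets of finite measure neither is infinite.
\<close>

definition carleson :: "'a measure \<Rightarrow> 'a set multiset \<Rightarrow> ennreal" where
  "carleson M E =
     (SUP F \<in> {F. F \<subseteq># E}. (\<Sum>R\<in>#F. emeasure M R) / emeasure M (sh F))"

end

theory Submission
  imports Defs
begin

text \<open>
  The extremal collection is a sunflower: infinitely many rectangles of measure \<open>\<Lambda>\<close>, any two
  of which meet only in a common kernel of measure \<open>\<Lambda> - 1\<close>. Then \<open>n\<close> of them have total
  measure \<open>n \<Lambda>\<close> and a union of measure \<open>\<Lambda> - 1 + n\<close>; the ratio is at most \<open>\<Lambda>\<close>, and at least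
  \<open>\<Lambda> / 2\<close> once \<open>n \<ge> \<Lambda>\<close>. So \<open>N \<Lambda>\<close> petals suffice by pigeonhole. Such sunflowers arise from the
  rectangles \<open>[0, 2^k) \<times> [0, 2^-k)\<close> with point masses at the origin and at
  \<open>(3/4 * 2^k, 3/4 * 2^-k)\<close>, and \<open>\<mu>\<close> contains one translate of it for each \<open>\<Lambda>\<close>.
\<close>

text \<open>Translation by \<open>L\<close> along \<open>b\<close> keeps that side dyadic, as
  \<open>L\<close> is a multiple of \<open>1 / 2 ^ k\<close>. The side stays within the unit
  interval starting at \<open>L\<close>, so different \<open>L\<close> give disjoint
  sunflowers.\<close>

definition petal_side :: "'d \<Rightarrow> 'd \<Rightarrow> nat \<Rightarrow> nat \<Rightarrow> 'd \<Rightarrow> real set" where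
  "petal_side a b L k j =
     (if j = a then {0..<2 ^ k} else if j = b then {real L..<real L + 1 / 2 ^ k} else {0..<1})"

definition petal :: "'d \<Rightarrow> 'd \<Rightarrow> nat \<Rightarrow> nat \<Rightarrow> (real ^ 'd) set" where
  "petal a b L k = {x. \<forall>j. x $ j \<in> petal_side a b L k j}"

text \<open>
  The indices \<open>i < L - 1\<close> all give the kernel point, which thereby receives mass \<open>L - 1\<close>;
  the petals of the \<open>L\<close>-th sunflower are those with index at least \<open>L - 1\<close>.
\<close>

definition atom :: "'d::finite \<Rightarrow> 'd \<Rightarrow> nat \<times> nat \<Rightarrow> real ^ 'd" where
  "atom a b = (\<lambda>(L, i). \<chi> j.
     if j = a then (if i < L - 1 then 0 else 3/4 * 2 ^ i)
     else if j = b then real L + (if i < L - 1 then 0 else 3/4 / 2 ^ i)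
     else 0)"

text \<open>Pushing forward the counting measure turns repeated atoms into mass: the measure of a
  Borel set is the number of indices sent into it.\<close>

definition sunflower_measure :: "'d::finite \<Rightarrow> 'd \<Rightarrow> (real ^ 'd) measure" where
  "sunflower_measure a b = distr (count_space UNIV) borel (atom a b)"

lemma dyadic_rectangle_petal: "dyadic_rectangle (petal a b L k)"
proof -
  have "dyadic_interval (petal_side a b L k j)" for j
  proof -
    have "{0..<2 ^ k :: real} = {of_int 0 * 2 powi int k..<(of_int 0 + 1) * 2 powi int k}"
      by simp
    moreover have "{real L..<real L + 1 / 2 ^ k} =
        {of_int (int L * 2 ^ k) * 2 powi (- int k)..<(of_int (int L * 2 ^ k) + 1) * 2 powi (- int k)}"
      by (simp add: power_int_minus field_simps)
    moreover have "{0..<1 :: real} = {of_int 0 * 2 powi 0..<(of_int 0 + 1) * 2 powi 0}"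
      by simp
    ultimately show ?thesis
      unfolding petal_side_def dyadic_interval_def by meson
  qed
  then show ?thesis
    unfolding dyadic_rectangle_def petal_def by blast
qed

lemma petal_borel:
  fixes a b :: "'d::finite"
  shows "petal a b L k \<in> sets borel"
proof -
  have "petal a b L k = (\<Inter>j. (\<lambda>x. x $ j) -` petal_side a b L k j)"
    by (auto simp: petal_def)
  moreover have "(\<lambda>x :: real ^ 'd. x $ j) -` petal_side a b L k j \<in> sets borel" for j
    using measurable_sets[of "\<lambda>x :: real ^ 'd. x $ j" borel borel "petal_side a b L k j"]
    by (auto simp: petal_side_def)
  ultimately show ?thesis
    by (auto intro!: sets.countable_INT)
qed

text \<open>The factor 3/4 lies between 1/2 and 1, so \<open>3/4 * 2 ^ i\<close> is below
  \<open>2 ^ i\<close> but above half of it.\<close>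

lemma three_quarters_power_less_iff: "3/4 * 2 ^ i < (2 ^ k :: real) \<longleftrightarrow> i \<le> k"
proof
  assume less: "3/4 * 2 ^ i < (2 ^ k :: real)"
  show "i \<le> k"
  proof (rule ccontr)
    assume "\<not> i \<le> k"
    then have "2 ^ Suc k \<le> (2 ^ i :: real)"
      by (intro power_increasing) auto
    then show False
      using less zero_less_power[of "2 :: real" k] by (simp del: zero_less_power)
  qed
next
  assume "i \<le> k"
  have "3/4 * 2 ^ i < (2 ^ i :: real)"
    by simp
  also have "\<dots> \<le> 2 ^ k"
    using \<open>i \<le> k\<close> by (intro power_increasing) auto
  finally show "3/4 * 2 ^ i < (2 ^ k :: real)" .
qed

text \<open>Kernel atoms sit at the lower corner of every petal of their sunflower. For any other
  atom the side along \<open>a\<close> forces \<open>i \<le> k\<close> and the side along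
  \<open>b\<close> forces \<open>k \<le> i\<close>.\<close>

lemma atom_mem_petal_iff:
  assumes "a \<noteq> b" and "L - 1 \<le> k"
  shows "atom a b (L', i) \<in> petal a b L k \<longleftrightarrow> L' = L \<and> (i < L - 1 \<or> i = k)"
proof -
  \<comment> \<open>The fractional part of the coordinate along \<open>b\<close>; the integer part
    of that coordinate then determines \<open>L'\<close>.\<close>
  define y where "y = (if i < L' - 1 then 0 else 3/4 / 2 ^ i :: real)"
  have y: "0 \<le> y" "y < 1"
    by (auto simp: y_def field_simps intro: less_le_trans[of 3 4] order_trans[of 4 "4 * 2 ^ i"])
  have "(1::real) / 2 ^ k \<le> 1"
    by simp
  with y have L: "L' = L" if "real L \<le> real L' + y" "real L' + y < real L + 1 / 2 ^ k"
    using that by linarith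
  \<comment> \<open>Clearing denominators exchanges the roles of \<open>i\<close> and
    \<open>k\<close>.\<close>
  have "3/4 / 2 ^ i < (1 / 2 ^ k :: real) \<longleftrightarrow> k \<le> i"
    using three_quarters_power_less_iff[of k i] by (simp add: field_simps)
  note iff = this three_quarters_power_less_iff[of i k]
  have "atom a b (L', i) \<in> petal a b L k \<longleftrightarrow>
      (if i < L' - 1 then 0 else 3/4 * 2 ^ i) < (2 ^ k :: real) \<and>
      real L \<le> real L' + y \<and> real L' + y < real L + 1 / 2 ^ k"
    using assms(1) by (auto simp: petal_def petal_side_def atom_def y_def)
  also have "\<dots> \<longleftrightarrow> L' = L \<and> (i < L - 1 \<or> i = k)"
    using L iff assms(2) y(1) by (auto simp: y_def)
  finally show ?thesis .
qed

text \<open>The preimage under \<open>atom\<close> contains the \<open>L - 1\<close> kernel indices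
  once, however many petals are united, and one further index per petal. An empty union would miss
  the kernel, hence \<open>K \<noteq> {}\<close>.\<close>

lemma emeasure_petals:
  assumes "a \<noteq> b" and "2 \<le> L" and "finite K" and "K \<noteq> {}" and "K \<subseteq> {L - 1..}"
  shows "emeasure (sunflower_measure a b) (\<Union>k\<in>K. petal a b L k) = of_nat (L - 1 + card K)"
proof -
  have "(L', i) \<in> atom a b -` (\<Union>k\<in>K. petal a b L k) \<longleftrightarrow> (\<exists>k\<in>K. L' = L \<and> (i < L - 1 \<or> i = k))"
    for L' i
    using assms(5) atom_mem_petal_iff[OF assms(1)] by (simp cong: bex_cong) blast
  then have "atom a b -` (\<Union>k\<in>K. petal a b L k) = {L} \<times> ({..<L - 1} \<union> K)"
    using assms(4) by (intro set_eqI) (simp only: split_paired_all, blast)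
  moreover have "card ({..<L - 1} \<union> K) = L - 1 + card K"
    using assms by (subst card_Un_disjoint) auto
  moreover have "(\<Union>k\<in>K. petal a b L k) \<in> sets borel"
    using assms by (intro sets.finite_UN petal_borel) auto
  ultimately show ?thesis
    using assms by (simp add: sunflower_measure_def emeasure_distr card_cartesian_product)
qed

corollary emeasure_petal:
  assumes "a \<noteq> b" and "2 \<le> L" and "L - 1 \<le> k"
  shows "emeasure (sunflower_measure a b) (petal a b L k) = of_nat L"
  using emeasure_petals[of a b L "{k}"] assms by (simp flip: of_nat_Suc)

lemma carleson_ratio_petals:
  fixes a b :: "'d::finite"
  assumes "a \<noteq> b" and "2 \<le> L" and "finite A" and "A \<subseteq> {L - 1..}"
    and "F \<subseteq># image_mset (petal a b L) (mset_set A)"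
  shows "(\<Sum>R\<in>#F. emeasure (sunflower_measure a b) R) / emeasure (sunflower_measure a b) (sh F) =
    of_nat (size F * L) / of_nat (L - 1 + size F)"
\<comment> \<open>For empty \<open>F\<close> both sides are 0, the left one by the convention 0/0 =
  0.\<close>
proof (cases "F = {#}")
  case False
  \<comment> \<open>\<open>F\<close> is pulled back to a multiset of indices, which inherits from
    \<open>mset_set A\<close> that nothing is repeated and so is a finite set
    \<open>K\<close>.\<close>
  obtain M where M: "M \<subseteq># mset_set A" "F = image_mset (petal a b L) M"
    using assms(5) image_mset_eq_plusD[of "petal a b L" "mset_set A" F]
    by (metis mset_subset_eq_add_left mset_subset_eq_exists_conv)
  define K where "K = set_mset M"
  have "count M x \<le> 1" for x
    using mset_subset_eq_count[OF M(1), of x] by (cases "x \<in> A") (auto simp: assms(3))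
  then have "M = mset_set K"
    by (intro multiset_eqI) (auto simp: K_def count_mset_set' not_in_iff le_antisym)
  moreover have K: "finite K" "K \<subseteq> {L - 1..}"
    using M(1) assms(3,4) set_mset_mono[of M "mset_set A"] by (auto simp: K_def)
  ultimately have F: "F = image_mset (petal a b L) (mset_set K)" and size: "size F = card K"
    using M by auto
  have "(\<Sum>R\<in>#F. emeasure (sunflower_measure a b) R) = (\<Sum>k\<in>K. of_nat L)"
    unfolding F image_mset.compositionality comp_def sum_unfold_sum_mset[symmetric]
    using K emeasure_petal[OF assms(1,2)] by (intro sum.cong) auto
  moreover have "emeasure (sunflower_measure a b) (sh F) = of_nat (L - 1 + card K)"
    using emeasure_petals[OF assms(1,2) K(1) _ K(2)] K(1) False
    by (auto simp: sh_def F mset_set_empty_iff)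
  ultimately show ?thesis
    by (simp add: size)
qed (auto simp: sh_def)

lemma sunflower_ratio_le:
  assumes "2 \<le> L"
  shows "of_nat (n * L) / of_nat (L - 1 + n) \<le> (of_nat L :: ennreal)"
proof -
  have "n * L \<le> (L - 1 + n) * L"
    by (intro mult_right_mono) auto
  then have "of_nat (n * L) \<le> (of_nat (L - 1 + n) * of_nat L :: ennreal)"
    by (metis of_nat_le_iff of_nat_mult)
  moreover have "0 < (of_nat (L - 1 + n) :: ennreal)"
    using assms by (metis One_nat_def Suc_le_eq add_gr_0 diff_is_0_eq neq0_conv not_less_eq_eq
      numeral_2_eq_2 of_nat_0_less_iff)
  ultimately show ?thesis
    by (intro divide_le_posI_ennreal)
qed

lemma sunflower_ratio_ge:
  assumes "2 \<le> L" and "L \<le> n"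
  shows "(of_nat L / 2 :: ennreal) \<le> of_nat (n * L) / of_nat (L - 1 + n)"
proof -
  \<comment> \<open>From \<open>L \<le> n\<close> the denominator \<open>L - 1 + n\<close> is at
    most \<open>2 * n\<close>.\<close>
  have "(L - 1 + n) * L \<le> 2 * n * L"
    using assms by (intro mult_right_mono) auto
  then have "real (L - 1 + n) * real L \<le> 2 * real (n * L)"
    by (metis mult.assoc of_nat_le_iff of_nat_mult of_nat_numeral)
  moreover have "0 < real (L - 1 + n)"
    using assms(1) by simp
  ultimately have "real L / 2 \<le> real (n * L) / real (L - 1 + n)"
    by (subst pos_le_divide_eq) (auto simp: mult.commute)
  then have "ennreal (real L / 2) \<le> ennreal (real (n * L) / real (L - 1 + n))"
    by (rule ennreal_leI)
  moreover have "ennreal (real L / 2) = of_nat L / 2"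
    by (subst divide_ennreal[symmetric]) (auto simp: ennreal_of_nat_eq_real_of_nat)
  moreover have "ennreal (real (n * L) / real (L - 1 + n)) = of_nat (n * L) / of_nat (L - 1 + n)"
    using assms(1) by (subst divide_ennreal[symmetric]) (auto simp: ennreal_of_nat_eq_real_of_nat)
  ultimately show ?thesis
    by simp
qed

theorem theorem4p4:
  assumes "CARD('d::finite) \<ge> 2"
  shows "\<exists>\<mu> :: (real ^ 'd) measure. sets \<mu> = sets borel \<and>
    (\<forall>(N::nat) (\<Lambda>::nat). N \<ge> 1 \<longrightarrow> \<Lambda> \<ge> 2 \<longrightarrow>
      (\<exists>E :: (real ^ 'd) set multiset.
        (\<forall>R \<in># E. dyadic_rectangle R \<and> emeasure \<mu> R < \<infinity>) \<and>
        carleson \<mu> E \<le> of_nat \<Lambda> \<and>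
        (\<forall>P :: nat \<Rightarrow> (real ^ 'd) set multiset.
          (\<Sum>i<N. P i) = E \<longrightarrow>
          (\<exists>i<N. carleson \<mu> (P i) \<ge> of_nat \<Lambda> / 2))))"
proof -
  \<comment> \<open>Petals grow along one coordinate and shrink along another.\<close>
  obtain a b :: 'd where ab: "a \<noteq> b"
    using assms by (metis card_le_Suc0_iff_eq finite not_less_eq_eq numeral_2_eq_2)
  define \<mu> where "\<mu> = sunflower_measure a b"
  show ?thesis
  proof (intro exI[of _ \<mu>] conjI allI impI)
    show "sets \<mu> = sets borel"
      by (simp add: \<mu>_def sunflower_measure_def)
  next
    fix N L :: nat
    assume N: "N \<ge> 1" and L: "L \<ge> 2"
    \<comment> \<open>Indices below \<open>L - 1\<close> belong to the kernel. With
      \<open>N * L\<close> petals, one of \<open>N\<close> parts must receive at least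
      \<open>L\<close>.\<close>
    define A where "A = {L - 1..<L - 1 + N * L}"
    define E where "E = image_mset (petal a b L) (mset_set A)"
    have ratio: "(\<Sum>R\<in>#F. emeasure \<mu> R) / emeasure \<mu> (sh F) =
        of_nat (size F * L) / of_nat (L - 1 + size F)" if "F \<subseteq># E" for F
      using that unfolding \<mu>_def E_def
      by (intro carleson_ratio_petals[OF ab L]) (auto simp: A_def)
    show "\<exists>E. (\<forall>R \<in># E. dyadic_rectangle R \<and> emeasure \<mu> R < \<infinity>) \<and>
        carleson \<mu> E \<le> of_nat L \<and>
        (\<forall>P. (\<Sum>i<N. P i) = E \<longrightarrow> (\<exists>i<N. carleson \<mu> (P i) \<ge> of_nat L / 2))"
    proof (intro exI[of _ E] conjI ballI allI impI)
      fix R assume "R \<in># E"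
      then obtain k where "L - 1 \<le> k" "R = petal a b L k"
        by (auto simp: E_def A_def)
      then show "dyadic_rectangle R" "emeasure \<mu> R < \<infinity>"
        using emeasure_petal[OF ab L] by (auto simp: \<mu>_def dyadic_rectangle_petal of_nat_less_top)
    next
      show "carleson \<mu> E \<le> of_nat L"
        unfolding carleson_def using sunflower_ratio_le[OF L] by (auto intro!: SUP_least simp: ratio)
    next
      fix P :: "nat \<Rightarrow> (real ^ 'd) set multiset"
      assume P: "(\<Sum>i<N. P i) = E"
      have "(\<Sum>i<N. size (P i)) = N * L"
        using P by (simp add: E_def A_def flip: size_multiset_sum)
      moreover have "(\<Sum>i<N. size (P i)) < (\<Sum>i<N. L)" if "\<forall>i<N. size (P i) < L"
        using that N by (intro sum_strict_mono) (auto simp: lessThan_empty_iff)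
      ultimately obtain i where i: "i < N" "L \<le> size (P i)"
        by (force simp: not_le[symmetric])
      have "P i \<subseteq># E"
        using i(1) by (simp flip: P add: sum.remove[of "{..<N}" i])
      then have "of_nat L / 2 \<le> (\<Sum>R\<in>#P i. emeasure \<mu> R) / emeasure \<mu> (sh (P i))"
        using sunflower_ratio_ge[OF L i(2)] by (simp add: ratio)
      \<comment> \<open>\<open>P i\<close> is itself one of the subcollections in the
        supremum.\<close>
      also have "\<dots> \<le> carleson \<mu> (P i)"
        unfolding carleson_def by (rule SUP_upper) simp
      finally show "\<exists>i<N. carleson \<mu> (P i) \<ge> of_nat L / 2"
        using i(1) by blast
    qed
  qed
qed

end
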